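(* Let $q=3^n$ with $n\ge 3$. Let \[ f(X)=aX+\frac{1}{X-r_1}+\frac{1}{X-r_2}+\frac{1}{X-r_3}, \] where $a\in\mathbb{F}_q^*$, $r\in\mathbb{F}_{q^3}\setminus\mathbb{F}_q$, and $r_1=r$, $r_2=r^q$, $r_3=r^{q^2}$. Then $f$ is a permutation rational function of $\mathbb{P}^1(\mathbb{F}_q)$ if and only if $r_1+r_2+r_3=0$ and $a=-(r_1-r_2)^{-2}$.
   Context: $\mathbb{P}^1(\mathbb{F}_q)=\mathbb{F}_q\cup\{\infty\}$ is the projective line over $\mathbb{F}_q$. A rational function $f=P/Q\in\mathbb{F}_q(X)$ ($P,Q$ coprime) defines a map $\mathbb{P}^1(\mathbb{F}_q)\to\mathbb{P}^1(\mathbb{F}_q)$ in the usual way (zeros of $Q$ map to $\infty$, and $f(\infty)$ is the limiting value). A permutation rational function of $\mathbb{P}^1(\mathbb{F}_q)$ is a rational function whose induced map on $\mathbb{P}^1(\mathbb{F}_q)$ is a bijection. *)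

theory Defs
  imports "HOL-Computational_Algebra.Polynomial_Factorial" "HOL-Library.Cardinality"
begin

definition is_subfield :: "'a::field set \<Rightarrow> bool" where
  "is_subfield K \<longleftrightarrow> 0 \<in> K \<and> 1 \<in> K \<and>
     (\<forall>x\<in>K. \<forall>y\<in>K. x + y \<in> K \<and> x * y \<in> K) \<and>
     (\<forall>x\<in>K. - x \<in> K \<and> inverse x \<in> K)"

datatype 'a proj_point = Affine 'a | Infinity

definition proj_line :: "'a set \<Rightarrow> 'a proj_point set" where
  "proj_line K = insert Infinity (Affine ` K)"

definition ratfun_over :: "'a::field set \<Rightarrow> 'a poly fract set" where
  "ratfun_over K = {Fraction_Field.Fract P Q | P Q.
     (\<forall>i. coeff P i \<in> K) \<and> (\<forall>i. coeff Q i \<in> K) \<and> Q \<noteq> 0}"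

text \<open>Only meaningful for coprime \<open>P\<close> and \<open>Q \<noteq> 0\<close>. If \<open>degree P < degree Q\<close>,
  then \<open>coeff P (degree Q) = 0\<close>, so the value at infinity is \<open>0\<close>.\<close>

fun quot_eval :: "'a::field poly \<Rightarrow> 'a poly \<Rightarrow> 'a proj_point \<Rightarrow> 'a proj_point" where
  "quot_eval P Q (Affine x) =
     (if poly Q x = 0 then Infinity else Affine (poly P x / poly Q x))"
| "quot_eval P Q Infinity =
     (if degree P > degree Q then Infinity
      else Affine (coeff P (degree Q) / lead_coeff Q))"

text \<open>The choice of the reduced representation does not matter; see \<open>ratfun_map_Fract\<close> below.\<close>

definition ratfun_map :: "'a::field poly fract \<Rightarrow> 'a proj_point \<Rightarrow> 'a proj_point" where
  "ratfun_map f =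
     (let (P, Q) = (SOME (P, Q). coprime P Q \<and> Q \<noteq> 0 \<and> f = Fraction_Field.Fract P Q)
      in quot_eval P Q)"

definition permutation_ratfun :: "'a::field set \<Rightarrow> 'a poly fract \<Rightarrow> bool" where
  "permutation_ratfun K f \<longleftrightarrow>
     f \<in> ratfun_over K \<and> bij_betw (ratfun_map f) (proj_line K) (proj_line K)"

lemma quot_eval_smult:
  assumes "c \<noteq> 0"
  shows "quot_eval (smult c P) (smult c Q) x = quot_eval P Q x"
  using assms by (cases x) auto

lemma field_poly_bezout:
  fixes P Q :: "'a::field poly"
  shows "\<exists>d s t. d = s * P + t * Q \<and> d dvd P \<and> d dvd Q"
proof (induction "euclidean_size Q" arbitrary: P Q rule: less_induct)
  case less
  show ?case
  proof (cases "Q = 0")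
    case True
    then show ?thesis by (intro exI[of _ P] exI[of _ 1] exI[of _ 0]) simp
  next
    case False
    then have "euclidean_size (P mod Q) < euclidean_size Q"
      by (rule mod_size_less)
    then obtain d s t where d: "d = s * Q + t * (P mod Q)" "d dvd Q" "d dvd P mod Q"
      using less by blast
    have "d = t * P + (s - t * (P div Q)) * Q"
      using d(1) by (simp add: algebra_simps minus_div_mult_eq_mod[symmetric])
    moreover have "d dvd P"
      using d(2,3) by (simp add: dvd_mod_iff)
    ultimately show ?thesis using d(2) by blast
  qed
qed

lemma field_poly_euclid:
  fixes P Q R :: "'a::field poly"
  assumes "coprime P Q" "Q dvd P * R"
  shows "Q dvd R"
proof -
  obtain d s t where d: "d = s * P + t * Q" "d dvd P" "d dvd Q"
    using field_poly_bezout[of P Q] by blast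
  have "d dvd 1"
    using assms(1) d(2,3) by (rule coprime_common_divisor)
  have "d * R = s * (P * R) + Q * (t * R)"
    by (simp add: d(1) algebra_simps)
  then have "Q dvd d * R"
    using assms(2) by simp
  with \<open>d dvd 1\<close> show ?thesis
    by (simp add: dvd_mult_unit_iff')
qed

lemma ratfun_map_Fract:
  fixes P Q :: "'a::field poly"
  assumes "coprime P Q" "Q \<noteq> 0"
  shows "ratfun_map (Fraction_Field.Fract P Q) = quot_eval P Q"
proof -
  define R where "R = (SOME (P', Q'). coprime P' Q' \<and> Q' \<noteq> 0 \<and>
    Fraction_Field.Fract P Q = Fraction_Field.Fract P' Q')"
  obtain P' Q' where R: "R = (P', Q')" by (cases R)
  have "case R of (P', Q') \<Rightarrow> coprime P' Q' \<and> Q' \<noteq> 0 \<and>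
    Fraction_Field.Fract P Q = Fraction_Field.Fract P' Q'"
    unfolding R_def by (rule someI[of _ "(P, Q)"]) (use assms in auto)
  then have P'Q': "coprime P' Q'" "Q' \<noteq> 0"
    "Fraction_Field.Fract P Q = Fraction_Field.Fract P' Q'"
    by (auto simp: R)
  have eq: "P * Q' = P' * Q"
    using P'Q'(2,3) assms(2) by (simp add: eq_fract)
  have "Q dvd P * Q'" "Q' dvd P' * Q"
    unfolding eq by simp (simp add: eq[symmetric])
  then have "Q dvd Q'" "Q' dvd Q"
    using assms(1) P'Q'(1) by (auto intro: field_poly_euclid)
  then obtain u v where u: "Q' = Q * u" and v: "Q = Q' * v"
    by (elim dvdE)
  have "Q * (u * v) = Q * 1"
    using v unfolding u by (simp only: mult.assoc mult_1_right)
  with assms(2) have "u * v = 1"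
    by (subst (asm) mult_left_cancel)
  then have "u dvd 1"
    by (intro dvdI[of _ _ v]) simp
  then obtain c where c: "u = [:c:]" "c dvd 1"
    unfolding is_unit_poly_iff by blast
  then have "c \<noteq> 0"
    by auto
  have Q: "Q' = smult c Q"
    using u c by simp
  have "smult c P * Q = P' * Q"
    using eq by (simp add: Q)
  with assms(2) have "P' = smult c P"
    by (subst (asm) mult_right_cancel) auto
  then have "quot_eval P' Q' = quot_eval P Q"
    using Q \<open>c \<noteq> 0\<close> by (simp add: fun_eq_iff quot_eval_smult)
  then show ?thesis
    using R by (simp add: ratfun_map_def R_def)
qed

end

theory Submission
  imports Defs
begin

text \<open>
  A permutation of \<open>K = F\<^sub>q\<close> has vanishing power sums \<open>\<Sum> f(x)\<^sup>k\<close> for \<open>k < q - 1\<close>, and Carlitz' formula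
  \<open>\<Sum> (x - r)\<^sup>-\<^sup>k = (r\<^sup>q - r)\<^sup>-\<^sup>k\<close> makes these sums computable. The first one vanishes iff the three poles are
  equally spaced, \<open>r\<^sub>i = r + i d\<close>, which is the trace condition. Scaling by \<open>d\<close> then turns \<open>f\<close> into
  \<open>A y - 1 / L(y)\<close>, where \<open>A = a d\<^sup>2\<close> and \<open>L(y) = (y - \<rho>)\<^sup>3 - (y - \<rho>)\<close> with \<open>\<rho>\<^sup>q = \<rho> + 1\<close>. Its fifth power sum
  is \<open>A\<^sup>4 - A\<^sup>2\<close>, and for \<open>A = 1\<close> its eighth is \<open>1\<close>; hence \<open>A = - 1\<close>. Conversely, for \<open>A = - 1\<close> a
  collision would produce a zero of \<open>L\<close> in \<open>K\<close>.
\<close>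

section \<open>Finite subfields: Frobenius and power sums\<close>

lemma bij_betw_subfield_mult:
  assumes "is_subfield K" "c \<in> K" "c \<noteq> 0"
  shows "bij_betw (\<lambda>x. c * x) K K"
proof (rule bij_betw_byWitness[where f' = "\<lambda>x. inverse c * x"])
  show "\<forall>x\<in>K. inverse c * (c * x) = x" "\<forall>x\<in>K. c * (inverse c * x) = x"
    using assms(3) by (auto simp: mult.assoc[symmetric])
  show "(\<lambda>x. c * x) ` K \<subseteq> K" "(\<lambda>x. inverse c * x) ` K \<subseteq> K"
    using assms unfolding is_subfield_def by blast+
qed

lemma bij_betw_subfield_add:
  assumes "is_subfield K" "c \<in> K"
  shows "bij_betw (\<lambda>x. x + c) K K"
proof (rule bij_betw_byWitness[where f' = "\<lambda>x. x + - c"])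
  show "(\<lambda>x. x + c) ` K \<subseteq> K" "(\<lambda>x. x + - c) ` K \<subseteq> K"
    using assms unfolding is_subfield_def by blast+
qed auto

text \<open>Multiplication by \<open>x\<close> permutes the nonzero elements, so their product
  equals itself times \<open>x ^ (card K - 1)\<close>.\<close>

lemma subfield_power_card:
  fixes K :: "'a::field set"
  assumes K: "is_subfield K" "finite K" and x: "x \<in> K"
  shows "x ^ card K = x"
proof (cases "x = 0")
  case True
  have "K \<noteq> {}" using x by auto
  then show ?thesis using True K(2) by (simp add: card_gt_0_iff zero_power)
next
  case False
  have 0: "0 \<in> K" using K by (simp add: is_subfield_def)
  have bij: "bij_betw (\<lambda>y. x * y) (K - {0}) (K - {0})"
    using bij_betw_DiffI[OF bij_betw_subfield_mult[OF K(1) x False], of "{0}" "{0}"] 0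
    by (simp add: bij_betw_def)
  have "(\<Prod>y\<in>K - {0}. y) = (\<Prod>y\<in>K - {0}. x * y)"
    by (rule prod.reindex_bij_betw[OF bij, symmetric])
  also have "\<dots> = x ^ card (K - {0}) * (\<Prod>y\<in>K - {0}. y)"
    by (simp add: prod.distrib)
  finally have "x ^ card (K - {0}) = 1"
    using K(2) by (simp add: prod_zero_iff)
  moreover have "card K = Suc (card (K - {0}))"
    using card_Suc_Diff1[OF K(2) 0] by simp
  ultimately show ?thesis by simp
qed

text \<open>With \<open>q = card K\<close>, the polynomial \<open>X^q - X\<close> has at most
  \<open>q\<close> roots, and the elements of \<open>K\<close> already are that many.\<close>

lemma power_card_subfield_imp_mem:
  fixes K :: "'a::field set"
  assumes K: "is_subfield K" "finite K" and x: "x ^ card K = x"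
  shows "x \<in> K"
proof -
  have "{0, 1} \<subseteq> K" using K by (simp add: is_subfield_def)
  then have "card {0, 1 :: 'a} \<le> card K" using K(2) by (rule card_mono[rotated])
  then have c2: "card K \<ge> 2" by simp
  let ?p = "monom 1 (card K) - [:0, 1:] :: 'a poly"
  have deg: "degree ?p = card K"
    using c2 by (subst diff_conv_add_uminus, subst degree_add_eq_left) (auto simp: degree_monom_eq)
  then have p0: "?p \<noteq> 0" using c2 by auto
  have "K \<subseteq> {x. poly ?p x = 0}"
    using subfield_power_card[OF K] by (auto simp: poly_monom)
  moreover have "card {x. poly ?p x = 0} \<le> card K"
    using card_poly_roots_bound[OF p0] deg by simp
  ultimately have "K = {x. poly ?p x = 0}"
    by (intro card_seteq poly_roots_finite p0)
  then show ?thesis using x by (auto simp: poly_monom)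
qed

text \<open>Translation by 1 permutes \<open>K\<close>, so adding \<open>card K\<close> to the sum
  of the elements leaves it unchanged.\<close>

lemma of_nat_card_subfield:
  fixes K :: "'a::field set"
  assumes "is_subfield K"
  shows "of_nat (card K) = (0 :: 'a)"
proof -
  have "1 \<in> K" using assms by (simp add: is_subfield_def)
  have "(\<Sum>x\<in>K. x) = (\<Sum>x\<in>K. x + 1)"
    by (rule sum.reindex_bij_betw[OF bij_betw_subfield_add[OF assms \<open>1 \<in> K\<close>], symmetric])
  then show ?thesis by (simp add: sum.distrib)
qed

text \<open>Scaling by \<open>c\<close> multiplies the sum by \<open>c ^ m\<close>. Since
  \<open>X^m - 1\<close> has fewer than \<open>card K - 1\<close> roots for \<open>m > 0\<close>,
  some nonzero \<open>c\<close> has \<open>c ^ m \<noteq> 1\<close>. For \<open>m = 0\<close> the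
  convention \<open>0 ^ 0 = 1\<close> makes the sum \<open>card K\<close>, which is 0 in the
  field.\<close>

lemma sum_power_subfield_eq_0:
  fixes K :: "'a::field set"
  assumes K: "is_subfield K" "finite K" and m: "m < card K - 1"
  shows "(\<Sum>x\<in>K. x ^ m) = 0"
proof (cases "m = 0")
  case True
  then show ?thesis using of_nat_card_subfield[OF K(1)] by simp
next
  case False
  let ?p = "monom 1 m - 1 :: 'a poly"
  have deg: "degree ?p = m"
    using False by (subst diff_conv_add_uminus, subst degree_add_eq_left) (auto simp: degree_monom_eq)
  then have p0: "?p \<noteq> 0" using False by auto
  have "card {x. poly ?p x = 0} \<le> m"
    using card_poly_roots_bound[OF p0] deg by simp
  moreover have "card (K - {0}) = card K - 1"
    using K by (simp add: is_subfield_def)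
  ultimately have "\<not> K - {0} \<subseteq> {x. poly ?p x = 0}"
    using m card_mono[OF poly_roots_finite[OF p0], of "K - {0}"] by linarith
  then obtain c where c: "c \<in> K" "c \<noteq> 0" "c ^ m \<noteq> 1"
    by (auto simp: poly_monom)
  have "(\<Sum>x\<in>K. x ^ m) = (\<Sum>x\<in>K. (c * x) ^ m)"
    by (rule sum.reindex_bij_betw[OF bij_betw_subfield_mult[OF K(1) c(1,2)], symmetric])
  also have "\<dots> = c ^ m * (\<Sum>x\<in>K. x ^ m)"
    by (simp add: power_mult_distrib sum_distrib_left)
  finally show ?thesis using c(3) by simp
qed

lemma sum_power_subfield_eq_minus_1:
  fixes K :: "'a::field set"
  assumes K: "is_subfield K" "finite K"
  shows "(\<Sum>x\<in>K. x ^ (card K - 1)) = - 1"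
proof -
  have 0: "0 \<in> K" and 1: "1 \<in> K" using K by (auto simp: is_subfield_def)
  have card: "card K = Suc (card (K - {0}))"
    using card_Suc_Diff1[OF K(2) 0] by simp
  have pos: "card (K - {0}) \<noteq> 0" using 1 K(2) by auto
  have "x ^ (card K - 1) = 1" if "x \<in> K - {0}" for x
  proof -
    have "x * x ^ (card K - 1) = x * 1"
      using subfield_power_card[OF K, of x] that card by (metis DiffD1 diff_Suc_1 mult_1_right power_Suc)
    then show ?thesis using that by auto
  qed
  then have "(\<Sum>x\<in>K - {0}. x ^ (card K - 1)) = of_nat (card (K - {0}))"
    using sum.cong[of "K - {0}" "K - {0}" "\<lambda>x. x ^ (card K - 1)" "\<lambda>_. 1"] by simp
  \<comment> \<open>Exponent 0 has to be excluded because \<open>0 ^ 0 = 1\<close>.\<close>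
  moreover have "(0 :: 'a) ^ (card K - 1) = 0"
    using pos card by (simp add: zero_power)
  ultimately have "(\<Sum>x\<in>K. x ^ (card K - 1)) = of_nat (card (K - {0}))"
    using sum.remove[OF K(2) 0, of "\<lambda>x. x ^ (card K - 1)"] by simp
  then show ?thesis
    using of_nat_card_subfield[OF K(1)] card by (simp add: eq_neg_iff_add_eq_0 add.commute)
qed

text \<open>In the binomial expansion only \<open>x ^ (card K - 1)\<close> has a nonzero power sum,
  and in this range of \<open>m\<close> it can only be the leading term.\<close>

lemma sum_shifted_power_subfield:
  fixes K :: "'a::field set"
  assumes K: "is_subfield K" "finite K" and m: "m \<le> card K - 1"
  shows "(\<Sum>x\<in>K. (x - r) ^ m) = (if m = card K - 1 then - 1 else 0)"
proof -
  have "(\<Sum>x\<in>K. (x - r) ^ m) = (\<Sum>x\<in>K. \<Sum>k\<le>m. of_nat (m choose k) * x ^ k * (- r) ^ (m - k))"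
    by (simp add: binomial_ring[of _ "- r", simplified])
  also have "\<dots> = (\<Sum>k\<le>m. of_nat (m choose k) * (- r) ^ (m - k) * (\<Sum>x\<in>K. x ^ k))"
    unfolding sum_distrib_left by (subst sum.swap) (simp add: mult_ac)
  also have "\<dots> = (\<Sum>k\<le>m. if k = card K - 1 then of_nat (m choose k) * (- r) ^ (m - k) * (- 1) else 0)"
    using m sum_power_subfield_eq_0[OF K] sum_power_subfield_eq_minus_1[OF K]
    by (intro sum.cong) auto
  also have "\<dots> = (if m = card K - 1 then - 1 else 0)"
    using m by (auto simp: sum.delta)
  finally show ?thesis .
qed

section \<open>Characteristic three and Carlitz' formula\<close>

lemma char3_add_power3:
  fixes x y :: "'a::comm_ring_1"
  assumes "(3::'a) = 0"
  shows "(x + y) ^ 3 = x ^ 3 + y ^ 3"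
proof -
  have "(x + y) ^ 3 = x ^ 3 + y ^ 3 + 3 * (x ^ 2 * y + x * y ^ 2)"
    by (simp add: power3_eq_cube power2_eq_square algebra_simps)
  then show ?thesis using assms by simp
qed

lemma char3_add_power:
  fixes x y :: "'a::comm_ring_1"
  assumes "(3::'a) = 0"
  shows "(x + y) ^ (3 ^ n) = x ^ (3 ^ n) + y ^ (3 ^ n)"
  by (induction n) (simp_all add: mult.commute[of 3] power_mult char3_add_power3[OF assms])

lemma char3_diff_power:
  fixes x y :: "'a::comm_ring_1"
  assumes "(3::'a) = 0"
  shows "(x - y) ^ (3 ^ n) = x ^ (3 ^ n) - y ^ (3 ^ n)"
  using char3_add_power[OF assms, of "x - y" y n] by simp

text \<open>
  Carlitz: with \<open>\<beta> = x - r\<close> one has \<open>\<beta>\<^sup>q = \<beta> - (r\<^sup>q - r)\<close>; dividing by \<open>\<beta>\<^sup>k\<close> and summing over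
  \<open>x \<in> K\<close> turns this into a recursion on \<open>k\<close>.
\<close>
lemma sum_inverse_power_subfield:
  fixes K :: "'a::field set"
  assumes K: "is_subfield K" "finite K" "card K = 3 ^ n" and 3: "(3::'a) = 0"
    and r: "r \<notin> K" and k: "1 \<le> k" "k \<le> card K"
  shows "(\<Sum>x\<in>K. inverse (x - r) ^ k) = inverse (r ^ card K - r) ^ k"
proof -
  let ?q = "card K"
  define w where "w = r ^ ?q - r"
  define E where "E k = (\<Sum>x\<in>K. inverse (x - r) ^ k)" for k
  have w0: "w \<noteq> 0"
    using power_card_subfield_imp_mem[OF K(1,2), of r] r by (auto simp: w_def)
  have rec: "(\<Sum>x\<in>K. (x - r) ^ (?q - 1 - j)) = E j - w * E (Suc j)" if "j < ?q" for j
  proof -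
    have "(x - r) ^ (?q - 1 - j) = inverse (x - r) ^ j - w * inverse (x - r) ^ Suc j"
      if x: "x \<in> K" for x
    proof -
      have ne: "x - r \<noteq> 0" using x r by auto
      have "(x - r) ^ ?q = (x - r) - w"
        using char3_diff_power[OF 3, of x r n] subfield_power_card[OF K(1,2) x] K(3)
        by (simp add: w_def)
      moreover have "(x - r) ^ ?q = (x - r) ^ (?q - 1 - j) * (x - r) ^ Suc j"
        using \<open>j < ?q\<close> by (simp del: power_Suc add: power_add[symmetric])
      ultimately have "(x - r) ^ (?q - 1 - j) * (x - r) ^ Suc j = (x - r) - w" by simp
      then have "(x - r) ^ (?q - 1 - j) = ((x - r) - w) * inverse (x - r) ^ Suc j"
        using ne by (metis mult.assoc mult_1_right power_inverse power_not_zero right_inverse)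
      also have "\<dots> = inverse (x - r) ^ j - w * inverse (x - r) ^ Suc j"
      proof -
        have "(\<beta> - w) * inverse \<beta> ^ Suc j = inverse \<beta> ^ j - w * inverse \<beta> ^ Suc j"
          if "\<beta> \<noteq> 0" for \<beta> :: 'a
          using that by (simp add: left_diff_distrib mult.assoc[symmetric])
        then show ?thesis using ne by blast
      qed
      finally show ?thesis .
    qed
    then show ?thesis
      by (simp add: E_def sum_subtractf sum_distrib_left)
  qed
  have "k \<le> ?q \<Longrightarrow> E k = inverse w ^ k"
    using k(1)
  proof (induction k rule: dec_induct)
    case base
    \<comment> \<open>Only for \<open>j = 0\<close> is the left side of \<open>rec\<close> nonzero:
      the exponent \<open>card K - 1\<close> gives -1, hence \<open>w * E 1 = 1\<close>. All later
      exponents are smaller and give 0.\<close>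
    have "E 0 = 0" using of_nat_card_subfield[OF K(1)] by (simp add: E_def)
    then show ?case
      using rec[of 0] sum_shifted_power_subfield[OF K(1,2), of "?q - 1" r] base w0
      by (simp add: field_simps)
  next
    case (step j)
    have "E j = w * E (Suc j)"
    proof -
      have "?q - 1 - j \<le> ?q - 1" "?q - 1 - j \<noteq> ?q - 1" "j < ?q"
        using step by linarith+
      then show ?thesis
        using rec[of j] sum_shifted_power_subfield[OF K(1,2), of "?q - 1 - j" r] by simp
    qed
    then show ?case using step w0 by (simp add: field_simps)
  qed
  then show ?thesis using k by (simp add: E_def w_def)
qed


section \<open>The normalised function with poles \<open>\<rho>\<close>, \<open>\<rho> + 1\<close>,
  \<open>\<rho> - 1\<close>\<close>

locale artin_schreier_pole =
  fixes K :: "'a::field set" and n :: nat and \<rho> :: 'a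
  assumes subfield: "is_subfield K" and fin: "finite K" and card: "card K = 3 ^ n"
    and char3: "(3::'a) = 0" and Frobenius_pole: "\<rho> ^ card K = \<rho> + 1"
begin

text \<open>The monic cubic whose roots are the three rescaled poles. In characteristic three it is
  additive up to a constant.\<close>

definition L :: "'a \<Rightarrow> 'a" where
  "L y = (y - \<rho>) ^ 3 - (y - \<rho>)"

definition l :: "'a \<Rightarrow> 'a" where
  "l y = inverse (L y)"

lemma mem [simp]: "0 \<in> K" "1 \<in> K" "x \<in> K \<Longrightarrow> y \<in> K \<Longrightarrow> x + y \<in> K"
  "x \<in> K \<Longrightarrow> y \<in> K \<Longrightarrow> x * y \<in> K" "x \<in> K \<Longrightarrow> - x \<in> K" "x \<in> K \<Longrightarrow> inverse x \<in> K"
  using subfield by (auto simp: is_subfield_def)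

lemma mem_diff [simp]: "x \<in> K \<Longrightarrow> y \<in> K \<Longrightarrow> x - y \<in> K"
  using mem(3)[of x "- y"] by simp

lemma mem_power [simp]: "x \<in> K \<Longrightarrow> x ^ k \<in> K"
  by (induction k) auto

lemma pole_not_mem: "\<rho> \<notin> K"
  using subfield_power_card[OF subfield fin, of \<rho>] Frobenius_pole by auto

lemma two_eq: "(2::'a) = - 1"
proof -
  have "(2::'a) = 3 - 1" by simp
  then show ?thesis using char3 by simp
qed

lemma L_nonzero:
  assumes "y \<in> K"
  shows "y - \<rho> \<noteq> 0" "y - \<rho> - 1 \<noteq> 0" "y - \<rho> + 1 \<noteq> 0" "L y \<noteq> 0"
proof -
  have ne: "y - \<rho> - c \<noteq> 0" if "c \<in> K" for c
  proof
    assume "y - \<rho> - c = 0"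
    then have "\<rho> = y - c" by (simp add: algebra_simps)
    then show False using pole_not_mem assms that by simp
  qed
  show 1: "y - \<rho> \<noteq> 0" "y - \<rho> - 1 \<noteq> 0" "y - \<rho> + 1 \<noteq> 0"
    using ne[of 0] ne[of 1] ne[of "- 1"] by auto
  have "L y = (y - \<rho>) * (y - \<rho> - 1) * (y - \<rho> + 1)"
    by (simp add: L_def power3_eq_cube algebra_simps)
  then show "L y \<noteq> 0" using 1 by simp
qed

lemma L_eq: "L y = y ^ 3 - y - (\<rho> ^ 3 - \<rho>)"
  using char3_diff_power[OF char3, of y \<rho> 1] by (simp add: L_def)

lemma L_shift: "L (y + 1) = L y"
  using char3_add_power[OF char3, of y 1 1] by (simp add: L_eq)

lemma l_shift: "l (y + 1) = l y"
  by (simp add: l_def L_shift)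

lemma sum_shift: "(\<Sum>y\<in>K. h (y + 1)) = (\<Sum>y\<in>K. h y)"
  by (rule sum.reindex_bij_betw[OF bij_betw_subfield_add[OF subfield mem(2)]])

text \<open>Since \<open>(y + 1) ^ 3 = y ^ 3 + 1\<close>, shifting by 1 adds the sum of
  \<open>h\<close> to the sum of \<open>y ^ 3 * h y\<close>; but the shift only permutes
  \<open>K\<close>.\<close>

lemma sum_periodic_eq_0:
  fixes h :: "'a \<Rightarrow> 'a"
  assumes "\<And>y. y \<in> K \<Longrightarrow> h (y + 1) = h y"
  shows "(\<Sum>y\<in>K. h y) = 0"
proof -
  have "(\<Sum>y\<in>K. y ^ 3 * h y) = (\<Sum>y\<in>K. (y + 1) ^ 3 * h (y + 1))"
    by (rule sum_shift[symmetric])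
  also have "\<dots> = (\<Sum>y\<in>K. y ^ 3 * h y + h y)"
    using char3_add_power3[OF char3, of _ 1] assms by (intro sum.cong) (auto simp: algebra_simps)
  finally show ?thesis by (simp add: sum.distrib)
qed

text \<open>The same shift with weight \<open>y ^ 2\<close> adds twice this sum and a sum that
  vanishes by periodicity; 2 is invertible.\<close>

lemma sum_id_mult_periodic_eq_0:
  assumes "\<And>y. y \<in> K \<Longrightarrow> h (y + 1) = h y"
  shows "(\<Sum>y\<in>K. y * h y) = 0"
proof -
  have "(\<Sum>y\<in>K. y ^ 2 * h y) = (\<Sum>y\<in>K. (y + 1) ^ 2 * h (y + 1))"
    by (rule sum_shift[symmetric])
  also have "\<dots> = (\<Sum>y\<in>K. y ^ 2 * h y + (2 * (y * h y) + h y))"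
    using assms by (intro sum.cong) (auto simp: algebra_simps power2_eq_square)
  finally have "2 * (\<Sum>y\<in>K. y * h y) + (\<Sum>y\<in>K. h y) = 0"
    by (simp add: sum.distrib sum_distrib_left)
  then show ?thesis
    using sum_periodic_eq_0[of h] assms by (simp add: two_eq)
qed

text \<open>
  \<open>\<Sum>\<^sub>i (y + i)\<^sup>2 = - 1\<close> over the prime field, so that translating the three poles
  onto one another reduces the sum to the Carlitz sum at \<open>\<rho>\<close>.
\<close>
lemma sum_square_mult_pole_powers:
  assumes "1 \<le> k" "k \<le> card K"
  shows "(\<Sum>y\<in>K. y ^ 2 * (inverse (y - \<rho>) ^ k + inverse (y - \<rho> - 1) ^ k + inverse (y - \<rho> + 1) ^ k))
    = - 1"
proof -
  let ?h = "\<lambda>y. inverse (y - \<rho>) ^ k"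
  have 1: "(\<Sum>y\<in>K. y ^ 2 * inverse (y - \<rho> - 1) ^ k) = (\<Sum>y\<in>K. (y + 1) ^ 2 * ?h y)"
    using sum_shift[of "\<lambda>y. y ^ 2 * inverse (y - \<rho> - 1) ^ k"] by (simp add: algebra_simps)
  have 2: "(\<Sum>y\<in>K. y ^ 2 * inverse (y - \<rho> + 1) ^ k) = (\<Sum>y\<in>K. (y - 1) ^ 2 * ?h y)"
    using sum_shift[of "\<lambda>y. (y - 1) ^ 2 * ?h y"] by (simp add: algebra_simps)
  have "(\<Sum>y\<in>K. y ^ 2 * (?h y + inverse (y - \<rho> - 1) ^ k + inverse (y - \<rho> + 1) ^ k))
      = (\<Sum>y\<in>K. y ^ 2 * ?h y + (y + 1) ^ 2 * ?h y + (y - 1) ^ 2 * ?h y)"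
    by (simp add: 1 2 sum.distrib distrib_left)
  also have "\<dots> = (\<Sum>y\<in>K. 3 * (y ^ 2 * ?h y) + 2 * ?h y)"
    by (intro sum.cong) (auto simp: algebra_simps power2_eq_square)
  also have "\<dots> = - (\<Sum>y\<in>K. ?h y)"
    by (simp add: char3 two_eq sum_negf)
  also have "(\<Sum>y\<in>K. ?h y) = 1"
    using sum_inverse_power_subfield[OF subfield fin card char3 pole_not_mem assms]
    by (simp add: Frobenius_pole)
  finally show ?thesis .
qed

text \<open>The \<open>p k\<close> are power sums of the reciprocals of the linear factors of
  \<open>L y\<close>. The elementary symmetric functions of these reciprocals are
  \<open>- l y\<close>, \<open>0\<close> and \<open>l y\<close>; Newton's identities give
  \<open>p 2\<close> and \<open>p 4\<close>, and cubing \<open>p 1\<close> and \<open>p 2\<close>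
  gives \<open>p 3\<close> and \<open>p 6\<close>.\<close>

lemma pole_power_sums:
  assumes "y \<in> K"
  defines "p \<equiv> \<lambda>k. inverse (y - \<rho>) ^ k + inverse (y - \<rho> - 1) ^ k + inverse (y - \<rho> + 1) ^ k"
  shows "p 1 = - l y" "p 2 = l y ^ 2" "p 3 = - (l y ^ 3)" "p 4 = l y ^ 4 - l y ^ 2" "p 6 = l y ^ 6"
proof -
  define t where "t = y - \<rho>"
  define u v w where "u = inverse t" and "v = inverse (t - 1)" and "w = inverse (t + 1)"
  have ne: "t \<noteq> 0" "t - 1 \<noteq> 0" "t + 1 \<noteq> 0"
    using L_nonzero[OF assms(1)] by (simp_all add: t_def)
  have inv: "t * u = 1" "(t - 1) * v = 1" "(t + 1) * w = 1"
    using ne by (simp_all add: u_def v_def w_def)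
  have p: "p k = u ^ k + v ^ k + w ^ k" for k
    by (simp add: p_def u_def v_def w_def t_def)
  have Lt: "L y = t * (t - 1) * (t + 1)"
    by (simp add: L_def t_def power3_eq_cube algebra_simps)
  have e3: "u * v * w = l y"
    by (simp add: l_def Lt u_def v_def w_def)
  \<comment> \<open>Each product of two reciprocals is \<open>u * v * w\<close> times the remaining
    factor, and the factors \<open>t - 1\<close>, \<open>t\<close>, \<open>t + 1\<close> add up to
    \<open>3 * t\<close>.\<close>
  have "u * v + v * w + w * u = (u * v * w) * (3 * t)"
    using inv by algebra
  then have e2: "u * v + v * w + w * u = 0"
    unfolding char3 by simp
  have "u + v + w = u * ((t - 1) * v) * ((t + 1) * w) + v * (t * u) * ((t + 1) * w) + w * (t * u) * ((t - 1) * v)"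
    unfolding inv by simp
  also have "\<dots> = (u * v * w) * (3 * t ^ 2 - 1)"
    by algebra
  finally have "u + v + w = (u * v * w) * (3 * t ^ 2 - 1)" .
  then have e1: "u + v + w = - l y"
    unfolding char3 e3 by simp
  show "p 1 = - l y" by (simp add: p e1)
  have "p 2 = (u + v + w) ^ 2 - 2 * (u * v + v * w + w * u)"
    unfolding p by algebra
  then show p2: "p 2 = l y ^ 2" by (simp add: e1 e2)
  have cube: "(a + b + c) ^ 3 = a ^ 3 + b ^ 3 + c ^ 3" for a b c :: 'a
    by (simp add: char3_add_power3[OF char3])
  have "p 3 = (u + v + w) ^ 3" unfolding p cube ..
  then show "p 3 = - (l y ^ 3)" by (simp add: e1)
  have "p 4 = (u + v + w) ^ 4 - 4 * (u + v + w) ^ 2 * (u * v + v * w + w * u)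
      + 2 * (u * v + v * w + w * u) ^ 2 + 4 * (u + v + w) * (u * v * w)"
    unfolding p by algebra
  also have "\<dots> = l y ^ 4 - 4 * l y ^ 2"
    unfolding e1 e2 e3 by (simp add: power2_eq_square)
  also have "\<dots> = l y ^ 4 - l y ^ 2 - 3 * l y ^ 2"
    by (simp add: algebra_simps)
  finally show "p 4 = l y ^ 4 - l y ^ 2" by (simp add: char3)
  have "p 6 = (u ^ 2 + v ^ 2 + w ^ 2) ^ 3"
    unfolding p cube by (simp add: power_mult[symmetric])
  then show "p 6 = l y ^ 6"
    using p2 by (simp add: p power_mult[symmetric])
qed

lemma sum_square_mult_l:
  assumes "card K \<ge> 6"
  shows "(\<Sum>y\<in>K. y ^ 2 * l y) = 1" "(\<Sum>y\<in>K. y ^ 2 * l y ^ 2) = - 1"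
    "(\<Sum>y\<in>K. y ^ 2 * l y ^ 3) = 1" "(\<Sum>y\<in>K. y ^ 2 * l y ^ 4) = 1"
    "(\<Sum>y\<in>K. y ^ 2 * l y ^ 6) = - 1"
proof -
  note * = sum_square_mult_pole_powers
  have "(\<Sum>y\<in>K. y ^ 2 * - l y) = - 1"
    using *[of 1] assms by (simp only: pole_power_sums cong: sum.cong)
  then show "(\<Sum>y\<in>K. y ^ 2 * l y) = 1" by (simp add: sum_negf)
  show 2: "(\<Sum>y\<in>K. y ^ 2 * l y ^ 2) = - 1"
    using *[of 2] assms by (simp only: pole_power_sums cong: sum.cong)
  have "(\<Sum>y\<in>K. y ^ 2 * - (l y ^ 3)) = - 1"
    using *[of 3] assms by (simp only: pole_power_sums cong: sum.cong)
  then show "(\<Sum>y\<in>K. y ^ 2 * l y ^ 3) = 1" by (simp add: sum_negf)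
  have "(\<Sum>y\<in>K. y ^ 2 * (l y ^ 4 - l y ^ 2)) = - 1"
    using *[of 4] assms by (simp only: pole_power_sums cong: sum.cong)
  then have "(\<Sum>y\<in>K. y ^ 2 * l y ^ 4) + 2 = 0"
    using 2 by (simp add: right_diff_distrib sum_subtractf add.commute)
  then show "(\<Sum>y\<in>K. y ^ 2 * l y ^ 4) = 1" by (simp add: two_eq)
  show "(\<Sum>y\<in>K. y ^ 2 * l y ^ 6) = - 1"
    using *[of 6] assms by (simp only: pole_power_sums cong: sum.cong)
qed

text \<open>Once degrees in \<open>y\<close> are lowered to at most 2, this leaves only terms with
  \<open>y ^ 2\<close> to contribute.\<close>

lemma sum_l_power:
  "(\<Sum>y\<in>K. l y ^ k) = 0" "(\<Sum>y\<in>K. y * l y ^ k) = 0"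
  by (rule sum_periodic_eq_0 sum_id_mult_periodic_eq_0, simp add: l_shift)+

section \<open>The fifth and the eighth power sum\<close>

lemma l_L: "y \<in> K \<Longrightarrow> l y * L y = 1"
  using L_nonzero(4) by (simp add: l_def)


text \<open>The relation \<open>y ^ 3 * l y = y * l y + 1 + b * l y\<close>, from
  \<open>L y = y ^ 3 - y - b\<close>, lowers the degree in \<open>y\<close>. Only
  \<open>A ^ 4 * (y ^ 2 * l y)\<close> and \<open>- A ^ 2 * (y ^ 2 * l y ^ 3)\<close> have nonzero
  sums.\<close>

lemma sum_power_5:
  assumes "card K \<ge> 9"
  shows "(\<Sum>y\<in>K. (A * y - l y) ^ 5) = A ^ 4 - A ^ 2"
proof -
  define b where "b = \<rho> ^ 3 - \<rho>"
  \<comment> \<open>The exponents 0 and 1 of \<open>l y\<close> are kept explicit so that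
    \<open>sum_l_power\<close> matches.\<close>
  have expand: "(A * y - l y) ^ 5 = A ^ 5 * y ^ 5
      + (A ^ 4 * (y ^ 2 * l y) + A ^ 4 * (y * l y ^ 0) + A ^ 4 * b * (y * l y ^ 1))
      + (A ^ 3 * (y * l y ^ 2) + A ^ 3 * l y ^ 1 + A ^ 3 * b * l y ^ 2)
      - A ^ 2 * (y ^ 2 * l y ^ 3) - A * (y * l y ^ 4) - l y ^ 5" if "y \<in> K" for y
  proof -
    have y3: "y ^ 3 = y + L y + b"
      by (simp add: L_eq b_def)
    have l: "l y * L y = 1" using l_L[OF that] .
    \<comment> \<open>The binomial coefficients 5 and 10 are -1 and 1 modulo 3; the last bracket
      collects the multiples of 3.\<close>
    have "(A * y - l y) ^ 5 = A ^ 5 * y ^ 5 + A ^ 4 * y * (y ^ 3 * l y) + A ^ 3 * (y ^ 3 * l y) * l y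
      - A ^ 2 * (y ^ 2 * l y ^ 3) - A * (y * l y ^ 4) - l y ^ 5
      + 3 * (- 2 * A ^ 4 * y ^ 4 * l y + 3 * A ^ 3 * y ^ 3 * l y ^ 2 - 3 * A ^ 2 * y ^ 2 * l y ^ 3
        + 2 * A * y * l y ^ 4)"
      by algebra
    also have "y ^ 3 * l y = y * l y + 1 + b * l y"
      unfolding y3 using l by algebra
    finally show ?thesis
      by (simp add: char3 algebra_simps power2_eq_square)
  qed
  have "(\<Sum>y\<in>K. y ^ 5) = 0"
    using sum_power_subfield_eq_0[OF subfield fin, of 5] assms by simp
  then have "(\<Sum>y\<in>K. (A * y - l y) ^ 5) = A ^ 4 * (\<Sum>y\<in>K. y ^ 2 * l y) - A ^ 2 * (\<Sum>y\<in>K. y ^ 2 * l y ^ 3)"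
    by (simp only: expand sum.distrib sum_subtractf sum_distrib_left[symmetric] sum_l_power cong: sum.cong)
      simp
  then show ?thesis
    using sum_square_mult_l assms by simp
qed

text \<open>The fifth power sum \<open>A ^ 4 - A ^ 2\<close> vanishes at \<open>A = 1\<close> as
  well; the nonzero value here excludes that case.\<close>

lemma sum_power_8:
  assumes "card K \<ge> 10"
  shows "(\<Sum>y\<in>K. (y - l y) ^ 8) = 1"
proof -
  define b where "b = \<rho> ^ 3 - \<rho>"
  \<comment> \<open>The terms \<open>?t1\<close> to \<open>?t5\<close> are the reduced forms of
    \<open>y ^ 7 * l y\<close> down to \<open>y ^ 3 * l y ^ 5\<close>.\<close>
  have expand: "(y - l y) ^ 8 = y ^ 2 * y ^ 6
      + (y * l y ^ 1 + l y ^ 0 + b * l y ^ 1 + y * L y + b ^ 2 * (y * l y ^ 1) + 2 * (y ^ 2)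
          + 2 * b * (y ^ 2 * l y) + 2 * b * (y * l y ^ 0))
      + (y ^ 2 * l y ^ 2 + l y ^ 0 + b ^ 2 * l y ^ 2 + 2 * (y * l y ^ 1) + 2 * b * (y * l y ^ 2)
          + 2 * b * l y ^ 1)
      + (y * l y ^ 3 + l y ^ 2 + b * l y ^ 3 + y ^ 2 * l y ^ 2 + b * (y ^ 2 * l y ^ 3))
      + (y ^ 2 * l y ^ 4 + y * l y ^ 3 + b * (y * l y ^ 4))
      + (y * l y ^ 5 + l y ^ 4 + b * l y ^ 5)
      + y ^ 2 * l y ^ 6 + y * l y ^ 7 + l y ^ 8" (is "_ = _ + ?t1 + ?t2 + ?t3 + ?t4 + ?t5 + _ + _ + _")
    if "y \<in> K" for y
  proof -
    have y3: "y ^ 3 = y + L y + b"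
      by (simp add: L_eq b_def)
    have l: "l y * L y = 1" using l_L[OF that] .
    have *: "y ^ 3 * l y = y * l y + 1 + b * l y"
      unfolding y3 using l by algebra
    have "y ^ 7 * l y = y * y ^ 3 * (y ^ 3 * l y)" by algebra
    also have "\<dots> = y * (y + L y + b) * (y * l y + 1 + b * l y)"
      unfolding * unfolding y3 ..
    also have "\<dots> = y ^ 3 * l y + y * L y + b ^ 2 * (y * l y) + 2 * y ^ 2 + 2 * b * (y ^ 2 * l y) + 2 * b * y"
      using l by algebra
    also have "\<dots> = ?t1" unfolding * by simp
    finally have 1: "y ^ 7 * l y = ?t1" .
    have "y ^ 6 * l y ^ 2 = (y ^ 3 * l y) * (y ^ 3 * l y)" by algebra
    also have "\<dots> = ?t2" unfolding * by (simp add: algebra_simps power2_eq_square)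
    finally have 2: "y ^ 6 * l y ^ 2 = ?t2" .
    have "y ^ 5 * l y ^ 3 = y ^ 2 * (y ^ 3 * l y) * l y ^ 2" by algebra
    also have "\<dots> = y ^ 2 * (y * l y + 1 + b * l y) * l y ^ 2" unfolding * ..
    also have "\<dots> = (y ^ 3 * l y) * l y ^ 2 + y ^ 2 * l y ^ 2 + b * (y ^ 2 * l y ^ 3)"
      by algebra
    also have "\<dots> = ?t3" unfolding * by algebra
    finally have 3: "y ^ 5 * l y ^ 3 = ?t3" .
    have "y ^ 4 * l y ^ 4 = y * (y ^ 3 * l y) * l y ^ 3" by algebra
    also have "\<dots> = ?t4" unfolding * by algebra
    finally have 4: "y ^ 4 * l y ^ 4 = ?t4" .
    have "y ^ 3 * l y ^ 5 = (y ^ 3 * l y) * l y ^ 4" by algebra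
    also have "\<dots> = ?t5" unfolding * by algebra
    finally have 5: "y ^ 3 * l y ^ 5 = ?t5" .
    have sq: "(c - d) ^ 2 = c ^ 2 + c * d + d ^ 2" for c d :: 'a
    proof -
      have "(c - d) ^ 2 = c ^ 2 + c * d + d ^ 2 - 3 * (c * d)" by algebra
      then show ?thesis by (simp add: char3)
    qed
    \<comment> \<open>As 8 = 2 + 2 * 3 and cubing is additive, every monomial
      \<open>y ^ (8 - k) * l y ^ k\<close> receives coefficient 1.\<close>
    have "(y - l y) ^ 8 = (y - l y) ^ 2 * ((y - l y) ^ 3) ^ 2" by algebra
    also have "\<dots> = (y ^ 2 + y * l y + l y ^ 2) * ((y ^ 3) ^ 2 + y ^ 3 * l y ^ 3 + (l y ^ 3) ^ 2)"
      using char3_diff_power[OF char3, of y "l y" 1] by (simp add: sq)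
    also have "\<dots> = y ^ 2 * y ^ 6 + y ^ 7 * l y + y ^ 6 * l y ^ 2 + y ^ 5 * l y ^ 3
        + y ^ 4 * l y ^ 4 + y ^ 3 * l y ^ 5 + y ^ 2 * l y ^ 6 + y * l y ^ 7 + l y ^ 8"
      by algebra
    finally show ?thesis
      unfolding 1 2 3 4 5 .
  qed
  have "(\<Sum>y\<in>K. y ^ 2 * y ^ 6) = 0" "(\<Sum>y\<in>K. y ^ 2) = 0"
    using sum_power_subfield_eq_0[OF subfield fin, of 8] sum_power_subfield_eq_0[OF subfield fin, of 2] assms
    by (simp_all flip: power_add)
  moreover have "(\<Sum>y\<in>K. y * L y) = 0"
    by (rule sum_id_mult_periodic_eq_0) (rule L_shift)
  moreover have "card K \<ge> 6" using assms by simp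
  \<comment> \<open>The contributions are \<open>2 * b\<close> from \<open>?t1\<close>, -1 from
    \<open>?t2\<close>, \<open>b - 1\<close> from \<open>?t3\<close>, 1 from \<open>?t4\<close> and
    -1 from \<open>y ^ 2 * l y ^ 6\<close>.\<close>
  ultimately have "(\<Sum>y\<in>K. (y - l y) ^ 8) = 2 * b - 1 - 1 + b + 1 - 1"
    by (simp only: expand sum.distrib sum_distrib_left[symmetric] sum_l_power sum_square_mult_l cong: sum.cong)
      simp
  also have "\<dots> = 1 + 3 * (b - 1)" by algebra
  finally show ?thesis by (simp add: char3)
qed

section \<open>Injectivity for \<open>A = - 1\<close> and the resulting criterion\<close>

lemma L_mem:
  assumes "y \<in> K"
  shows "L y \<in> K"
proof -
  have q: "3 ^ n = card K" by (simp add: card)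
  \<comment> \<open>Frobenius moves \<open>\<rho>\<close> by 1, and \<open>x ^ 3 - x\<close> is
    invariant under that shift.\<close>
  have "(\<rho> ^ 3 - \<rho>) ^ card K = (\<rho> ^ card K) ^ 3 - \<rho> ^ card K"
    using char3_diff_power[OF char3, of "\<rho> ^ 3" \<rho> n] unfolding q
    by (simp add: power_mult[symmetric] mult.commute)
  also have "\<dots> = \<rho> ^ 3 - \<rho>"
    using char3_add_power3[OF char3, of \<rho> 1] by (simp add: Frobenius_pole)
  finally have "\<rho> ^ 3 - \<rho> \<in> K"
    by (rule power_card_subfield_imp_mem[OF subfield fin])
  then show ?thesis using assms by (simp add: L_eq)
qed

text \<open>
  A collision with \<open>w = y - z\<close> gives a quadratic equation for \<open>L y\<close> whose discriminant is
  \<open>(w\<^sup>2 - 1) (w\<^sup>2 + 1)\<^sup>2\<close>; a square root of \<open>w\<^sup>2 - 1\<close> in \<open>K\<close> yields a zero of \<open>L\<close> in \<open>K\<close>.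
\<close>
lemma inj_on_minus_l: "inj_on (\<lambda>y. - y - l y) K"
proof (rule inj_onI, rule ccontr)
  fix y z
  assume yz: "y \<in> K" "z \<in> K" "y \<noteq> z" and eq: "- y - l y = - z - l z"
  define w u v where "w = y - z" and "u = L y" and "v = L z"
  have ne: "u \<noteq> 0" "v \<noteq> 0" "w \<noteq> 0"
    using L_nonzero(4) yz by (auto simp: u_def v_def w_def)
  have mem': "u \<in> K" "w \<in> K" using yz by (auto simp: u_def w_def L_mem)
  have uv: "u - v = w ^ 3 - w"
    using char3_diff_power[OF char3, of y z 1] by (simp add: u_def v_def w_def L_eq)
  have "w = inverse v - inverse u"
    using eq by (simp add: w_def u_def v_def l_def algebra_simps)
  then have "w * (u * v) = u - v"
    using ne by (simp add: field_simps)
  then have "w * (u * v) = w * (w ^ 2 - 1)"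
    unfolding uv by (simp add: algebra_simps power2_eq_square power3_eq_cube)
  then have "u * v = w ^ 2 - 1"
    using ne by simp
  then have quad: "u ^ 2 = u * w * (w ^ 2 - 1) + (w ^ 2 - 1)"
    using uv by algebra
  \<comment> \<open>The square is completed with -1 = 2, and \<open>w ^ 4 - w ^ 2 + 1\<close> equals
    \<open>(w ^ 2 + 1) ^ 2\<close> modulo 3.\<close>
  have "(u + w * (w ^ 2 - 1)) ^ 2 = (w ^ 2 - 1) * (w ^ 2 + 1) ^ 2
      + 3 * (u * w * (w ^ 2 - 1) - w ^ 2 * (w ^ 2 - 1))"
    using quad by algebra
  then have disc: "(u + w * (w ^ 2 - 1)) ^ 2 = (w ^ 2 - 1) * (w ^ 2 + 1) ^ 2"
    by (simp add: char3)
  obtain s where s: "s \<in> K" "s ^ 2 = w ^ 2 - 1" "u = - (w * (w ^ 2 - 1) + s * (w ^ 2 + 1))"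
  proof (cases "w ^ 2 + 1 = 0")
    case True
    \<comment> \<open>Division by \<open>w ^ 2 + 1\<close> is impossible here, but
      \<open>w ^ 2 - 1 = 1\<close> has the square root 1.\<close>
    then have "w ^ 2 - 1 = - 1 - 1" by algebra
    also have "\<dots> = 1 - (3 :: 'a)" by simp
    finally have "w ^ 2 - 1 = 1" by (simp add: char3)
    moreover from disc True have "u + w * (w ^ 2 - 1) = 0" by simp
    ultimately show ?thesis using that[of 1] True by (simp add: eq_neg_iff_add_eq_0)
  next
    case False
    define s where "s = - (u + w * (w ^ 2 - 1)) * inverse (w ^ 2 + 1)"
    have s': "s * (w ^ 2 + 1) = - (u + w * (w ^ 2 - 1))"
      using False by (simp add: s_def)
    then have "s ^ 2 * (w ^ 2 + 1) ^ 2 = (w ^ 2 - 1) * (w ^ 2 + 1) ^ 2"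
      using disc by (metis power2_minus power_mult_distrib)
    then have "s ^ 2 = w ^ 2 - 1" using False by simp
    moreover have "s \<in> K" unfolding s_def using mem' by (intro mem mem_diff mem_power)
    moreover have "u = - (w * (w ^ 2 - 1) + s * (w ^ 2 + 1))" unfolding s' by simp
    ultimately show ?thesis using that by blast
  qed
  \<comment> \<open>Inserting \<open>w ^ 2 = s ^ 2 + 1\<close> turns \<open>s * (w ^ 2 + 1)\<close>
    into \<open>s ^ 3 + 2 * s\<close>. With \<open>c = w + s\<close> this says
    \<open>L y = - (c ^ 3 - c)\<close>, so \<open>y + c\<close> is a zero of
    \<open>L\<close>.\<close>
  have "u = (w + s) - (w ^ 3 + s ^ 3) - 3 * s"
    using s(2,3) by algebra
  then have "L y + (w + s) ^ 3 - (w + s) = 0"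
    by (simp add: char3 char3_add_power3 u_def)
  then have "L (y + (w + s)) = 0"
    by (simp add: L_eq char3_add_power3[OF char3] algebra_simps)
  then show False
    using L_nonzero(4)[of "y + (w + s)"] yz mem' s(1) by simp
qed

lemma bij_betw_iff:
  assumes q: "card K \<ge> 10" and A: "A \<in> K" "A \<noteq> 0"
  shows "bij_betw (\<lambda>y. A * y - l y) K K \<longleftrightarrow> A = - 1"
proof
  assume bij: "bij_betw (\<lambda>y. A * y - l y) K K"
  have psum: "(\<Sum>y\<in>K. (A * y - l y) ^ k) = 0" if "k < card K - 1" for k
    using sum.reindex_bij_betw[OF bij, of "\<lambda>x. x ^ k"] sum_power_subfield_eq_0[OF subfield fin that] by simp
  have "A ^ 4 - A ^ 2 = 0"
    using psum[of 5] sum_power_5[of A] q by simp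
  then have "A ^ 2 * ((A - 1) * (A + 1)) = 0" by algebra
  then have "A = 1 \<or> A = - 1" using A by (auto simp: eq_neg_iff_add_eq_0)
  moreover have "A \<noteq> 1"
  proof
    assume "A = 1"
    moreover have "8 < card K - 1" using q by linarith
    ultimately show False using psum[of 8] sum_power_8[OF q] by simp
  qed
  ultimately show "A = - 1" by blast
next
  assume "A = - 1"
  then have "inj_on (\<lambda>y. A * y - l y) K" using inj_on_minus_l by simp
  moreover have "(\<lambda>y. A * y - l y) ` K \<subseteq> K" using A(1) by (auto simp: l_def L_mem)
  ultimately show "bij_betw (\<lambda>y. A * y - l y) K K"
    using fin by (simp add: bij_betw_def endo_inj_surj)
qed

end

section \<open>Reduced fractions and maps of the projective line\<close>

lemma coprime_linear_poly:
  fixes p :: "'a::field poly"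
  assumes "poly p r \<noteq> 0"
  shows "coprime p [:- r, 1:]"
proof (rule coprimeI)
  fix c assume c: "c dvd p" "c dvd [:- r, 1:]"
  then obtain e where e: "[:- r, 1:] = c * e" by (elim dvdE)
  have "c \<noteq> 0" "e \<noteq> 0" using e by auto
  then have "degree c + degree e = 1"
    using e by (metis degree_mult_eq degree_pCons_eq_if degree_0 One_nat_def one_neq_zero pCons_eq_0_iff)
  moreover have "degree c \<noteq> 1"
  proof
    assume "degree c = 1"
    with \<open>degree c + degree e = 1\<close> have "degree e = 0" by simp
    then obtain k where k: "e = [:k:]" by (rule degree_eq_zeroE)
    with \<open>e \<noteq> 0\<close> have "k \<noteq> 0" by simp
    moreover have "poly c r * k = 0" using arg_cong[OF e, of "\<lambda>p. poly p r"] k by auto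
    ultimately have "poly c r = 0" by simp
    with c(1) assms show False by (auto elim!: dvdE)
  qed
  ultimately have "degree c = 0" by linarith
  then show "is_unit c" using \<open>c \<noteq> 0\<close> by (simp add: is_unit_iff_degree)
qed

lemma coprime_mult_field_poly:
  fixes p :: "'a::field poly"
  assumes "coprime p A" "coprime p B"
  shows "coprime p (A * B)"
proof (rule coprimeI)
  fix c assume c: "c dvd p" "c dvd A * B"
  have "coprime A c"
    using assms(1) c(1) by (meson coprime_def dvd_trans)
  then have "c dvd B" using c(2) by (rule field_poly_euclid)
  then show "is_unit c" using assms(2) c(1) by (simp add: coprime_common_divisor)
qed

lemma bij_betw_proj_line_iff:
  fixes h :: "'a \<Rightarrow> 'a"
  assumes "g Infinity = Infinity" "\<And>x. x \<in> K \<Longrightarrow> g (Affine x) = Affine (h x)"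
  shows "bij_betw g (proj_line K) (proj_line K) \<longleftrightarrow> bij_betw h K K"
proof -
  have "g ` proj_line K = insert Infinity (Affine ` h ` K)"
    using assms by (auto simp: proj_line_def image_image)
  moreover have "insert Infinity (Affine ` A) = insert Infinity (Affine ` B) \<longleftrightarrow> A = B" for A B :: "'a set"
    by (subst insert_ident) (auto simp: inj_image_eq_iff inj_def)
  ultimately have "g ` proj_line K = proj_line K \<longleftrightarrow> h ` K = K"
    by (simp add: proj_line_def)
  moreover have "inj_on g (proj_line K) \<longleftrightarrow> inj_on h K"
    using assms by (auto simp: inj_on_def proj_line_def)
  ultimately show ?thesis by (simp add: bij_betw_def)
qed

lemma coeff_pCons_mem:
  assumes "x \<in> K" "\<forall>i. coeff p i \<in> K"
  shows "\<forall>i. coeff (pCons x p) i \<in> K"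
  using assms by (auto simp: coeff_pCons split: nat.split)

lemma Fract_mem_ratfun_over:
  assumes "\<forall>i. coeff P i \<in> K" "\<forall>i. coeff Q i \<in> K" "Q \<noteq> 0"
  shows "Fraction_Field.Fract P Q \<in> ratfun_over K"
  unfolding ratfun_over_def using assms by blast

text \<open>The fraction over the common denominator is reduced: at each pole only one product of
  two linear factors survives in the numerator, and it is nonzero for distinct poles. As
  \<open>a \<noteq> 0\<close>, the degrees are 4 and 3.\<close>

lemma three_pole_ratfun:
  fixes a r1 r2 r3 :: "'a::field" and f :: "'a poly fract"
  assumes f: "f = to_fract [:0, a:] + 1 / to_fract [:- r1, 1:]
               + 1 / to_fract [:- r2, 1:] + 1 / to_fract [:- r3, 1:]"
    and a: "a \<noteq> 0" and r: "r1 \<noteq> r2" "r2 \<noteq> r3" "r1 \<noteq> r3"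
  defines "e1 \<equiv> r1 + r2 + r3" and "e2 \<equiv> r1 * r2 + r2 * r3 + r3 * r1" and "e3 \<equiv> r1 * r2 * r3"
  shows "f = Fraction_Field.Fract [:e2, - (a * e3) - 2 * e1, 3 + a * e2, - (a * e1), a:] [:- e3, e2, - e1, 1:]"
      (is "f = Fraction_Field.Fract ?P ?Q")
    and "ratfun_map f Infinity = Infinity"
    and "x \<notin> {r1, r2, r3} \<Longrightarrow>
      ratfun_map f (Affine x) = Affine (a * x + inverse (x - r1) + inverse (x - r2) + inverse (x - r3))"
proof -
  let ?l1 = "[:- r1, 1:]" and ?l2 = "[:- r2, 1:]" and ?l3 = "[:- r3, 1:]"
  have Q: "?Q = ?l1 * ?l2 * ?l3"
    by (simp add: e1_def e2_def e3_def algebra_simps)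
  have P: "?P = [:0, a:] * (?l1 * ?l2 * ?l3) + ?l2 * ?l3 + ?l1 * ?l3 + ?l1 * ?l2"
    by (simp add: e1_def e2_def e3_def algebra_simps)
  have "f = to_fract ?P / to_fract ?Q"
    unfolding f P Q by (simp add: field_simps del: mult_pCons_left mult_pCons_right)
  then show fr: "f = Fraction_Field.Fract ?P ?Q"
    by (simp add: Fract_conv_to_fract)
  have "poly ?P r1 \<noteq> 0" "poly ?P r2 \<noteq> 0" "poly ?P r3 \<noteq> 0"
    using r unfolding P by (simp_all del: mult_pCons_left mult_pCons_right)
  then have "coprime ?P ?Q"
    unfolding Q by (intro coprime_mult_field_poly coprime_linear_poly)
  then have map: "ratfun_map f = quot_eval ?P ?Q"
    unfolding fr by (rule ratfun_map_Fract) simp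
  show "ratfun_map f Infinity = Infinity"
    using a by (simp add: map)
  show "ratfun_map f (Affine x) = Affine (a * x + inverse (x - r1) + inverse (x - r2) + inverse (x - r3))"
    if x: "x \<notin> {r1, r2, r3}"
  proof -
    have ne: "x - r1 \<noteq> 0" "x - r2 \<noteq> 0" "x - r3 \<noteq> 0" using x by auto
    have PQ: "poly ?Q x = (x - r1) * (x - r2) * (x - r3)"
      "poly ?P x = a * x * ((x - r1) * (x - r2) * (x - r3)) + (x - r2) * (x - r3)
        + (x - r1) * (x - r3) + (x - r1) * (x - r2)"
      unfolding P Q by (simp_all del: mult_pCons_left mult_pCons_right)
    have "(c * (u * v * w) + v * w + u * w + u * v) / (u * v * w) = c + inverse u + inverse v + inverse w"
      if "u \<noteq> 0" "v \<noteq> 0" "w \<noteq> 0" for c u v w :: 'a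
      using that by (simp add: field_simps)
    from this[OF ne, of "a * x"] show ?thesis
      using ne unfolding map quot_eval.simps PQ by simp
  qed
qed

text \<open>Both elementary symmetric conditions together say \<open>(x - y)\<^sup>2 = 0\<close> in characteristic three.\<close>
lemma char3_equal_of_sum_inverse:
  fixes x y z :: "'a::field"
  assumes 3: "(3::'a) = 0" and nz: "x \<noteq> 0" "y \<noteq> 0" "z \<noteq> 0"
    and sum: "x + y + z = 0" and inv: "inverse x + inverse y + inverse z = 0"
  shows "x = y"
proof -
  have "x * y + y * z + z * x = x * y * z * (inverse x + inverse y + inverse z)"
    using nz by (simp add: field_simps)
  then have e2: "x * y + y * z + z * x = 0" using inv by simp
  have "(x - y) ^ 2 = - (3 * (x * y))"
    using e2 sum by algebra
  then have "(x - y) ^ 2 = 0" using 3 by simp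
  then show ?thesis by simp
qed

section \<open>Reduction of the three-pole function to the normalised one\<close>

theorem theorem4p5:
  fixes K :: "'l::{field,finite} set" and n q :: nat
    and a r r1 r2 r3 :: 'l and f :: "'l poly fract"
  assumes "n \<ge> 3" and "q = 3 ^ n"
    and "is_subfield K" and "card K = q" and "CARD('l) = q ^ 3"
    and "a \<in> K" and "a \<noteq> 0" and "r \<notin> K"
    and "r1 = r" and "r2 = r ^ q" and "r3 = r ^ (q\<^sup>2)"
    and "f = to_fract [:0, a:] + 1 / to_fract [:- r1, 1:]
               + 1 / to_fract [:- r2, 1:] + 1 / to_fract [:- r3, 1:]"
  shows "permutation_ratfun K f \<longleftrightarrow>
           r1 + r2 + r3 = 0 \<and> a = - inverse ((r1 - r2)\<^sup>2)"
proof -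
  note K = \<open>is_subfield K\<close>
  have fin: "finite K" by simp
  have UNIV: "is_subfield (UNIV :: 'l set)" by (simp add: is_subfield_def)
  \<comment> \<open>The whole field is a subfield of itself, so its cardinality is 0 in it.\<close>
  have "(3 :: 'l) ^ (n * 3) = 0"
    using of_nat_card_subfield[OF UNIV] assms(2,5) by (simp add: power_mult)
  then have 3: "(3 :: 'l) = 0" by simp
  have "(3::nat) ^ 3 \<le> 3 ^ n" using assms(1) by (intro power_increasing) auto
  then have q: "q \<ge> 27" using assms(2) by simp
  have add_q: "(x + y) ^ q = x ^ q + y ^ q" and diff_q: "(x - y) ^ q = x ^ q - y ^ q" for x y :: 'l
    unfolding assms(2) by (rule char3_add_power[OF 3] char3_diff_power[OF 3])+
  have K_iff: "x \<in> K \<longleftrightarrow> x ^ q = x" for x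
    using subfield_power_card[OF K fin] power_card_subfield_imp_mem[OF K fin] assms(4) by blast
  have cyc: "r1 ^ q = r2" "r2 ^ q = r3" "r3 ^ q = r1"
  proof -
    show "r1 ^ q = r2" "r2 ^ q = r3"
      using assms(9-11) by (simp_all add: power_mult[symmetric] power2_eq_square)
    have "r3 ^ q = r ^ q ^ 3"
      using assms(11) by (simp add: power_mult[symmetric] power2_eq_square power3_eq_cube)
    also have "\<dots> = r" using subfield_power_card[OF UNIV, of r] assms(5) by simp
    finally show "r3 ^ q = r1" using assms(9) by simp
  qed
  have r12: "r1 \<noteq> r2" using K_iff[of r1] cyc(1) assms(8,9) by auto
  have r23: "r2 \<noteq> r3" using cyc r12 by metis
  have r13: "r1 \<noteq> r3" using cyc r12 by metis
  have notin: "r1 \<notin> K" "r2 \<notin> K" "r3 \<notin> K"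
    using K_iff cyc r12 r23 r13 by auto
  define F where "F x = a * x + inverse (x - r1) + inverse (x - r2) + inverse (x - r3)" for x
  note ratfun = three_pole_ratfun[OF assms(12) assms(7) r12 r23 r13]
  have bij_iff: "bij_betw (ratfun_map f) (proj_line K) (proj_line K) \<longleftrightarrow> bij_betw F K K"
    unfolding F_def using notin by (intro bij_betw_proj_line_iff ratfun(2,3)) auto
  \<comment> \<open>Frobenius permutes the poles cyclically and therefore fixes \<open>F x\<close>;
    the same symmetry puts the coefficients of \<open>f\<close> into \<open>K\<close>.\<close>
  have F_mem: "F x \<in> K" if "x \<in> K" for x
    using that assms(6) unfolding K_iff F_def
    by (simp add: add_q diff_q power_mult_distrib power_inverse cyc)
  have ratfun_mem: "f \<in> ratfun_over K"
  proof -
    have e: "r1 + r2 + r3 \<in> K" "r1 * r2 + r2 * r3 + r3 * r1 \<in> K" "r1 * r2 * r3 \<in> K"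
      unfolding K_iff by (simp_all add: add_q power_mult_distrib cyc algebra_simps)
    have K': "0 \<in> K" "1 \<in> K" "\<And>x y. x \<in> K \<Longrightarrow> y \<in> K \<Longrightarrow> x - y \<in> K" "\<And>x y. x \<in> K \<Longrightarrow> y \<in> K \<Longrightarrow> x + y \<in> K"
      "\<And>x y. x \<in> K \<Longrightarrow> y \<in> K \<Longrightarrow> x * y \<in> K" "\<And>x. x \<in> K \<Longrightarrow> - x \<in> K"
      using K by (auto simp: is_subfield_def K_iff diff_q)
    have "2 \<in> K" "3 \<in> K" using K'(4)[OF K'(2,2)] K'(1) 3 by auto
    then have "\<forall>i. coeff [:c0, - (a * c3) - 2 * c1, 3 + a * c0, - (a * c1), a:] i \<in> K"
      "\<forall>i. coeff [:- c3, c0, - c1, 1:] i \<in> K" if "c0 \<in> K" "c1 \<in> K" "c3 \<in> K" for c0 c1 c3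
      using that assms(6) by (intro coeff_pCons_mem K'; simp add: K')+
    from this[OF e(2,1,3)] show ?thesis
      unfolding ratfun(1) by (rule Fract_mem_ratfun_over) simp
  qed
  have spaced: "bij_betw F K K \<longleftrightarrow> a = - inverse ((r1 - r2)\<^sup>2)" if eq: "r3 - r2 = r2 - r1"
  proof -
    define d where "d = r2 - r1"
    define \<rho> where "\<rho> = r1 / d"
    have d0: "d \<noteq> 0" using r12 by (simp add: d_def)
    \<comment> \<open>Frobenius sends \<open>r2 - r1\<close> to \<open>r3 - r2\<close>, which is the
      same difference by equal spacing.\<close>
    have dK: "d \<in> K" unfolding K_iff using eq by (simp add: d_def diff_q cyc)
    have r: "r1 = d * \<rho>" "r2 = d * (\<rho> + 1)" "r3 = d * (\<rho> - 1)"
    proof -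
      show 1: "r1 = d * \<rho>" using d0 by (simp add: \<rho>_def)
      show 2: "r2 = d * (\<rho> + 1)" using 1 by (simp add: d_def algebra_simps)
      have "r3 = r1 - d + 3 * d" using eq by (simp add: d_def algebra_simps)
      then show "r3 = d * (\<rho> - 1)" using 1 3 by (simp add: algebra_simps)
    qed
    have "\<rho> ^ q = r2 / d"
      using dK by (simp add: \<rho>_def power_divide cyc K_iff)
    also have "\<dots> = \<rho> + 1" using d0 r(2) by simp
    finally interpret artin_schreier_pole K n \<rho>
      using K 3 assms(2,4) by unfold_locales simp_all
    \<comment> \<open>Scaling by \<open>d\<close> permutes \<open>K\<close>, so composing with it on
      both sides preserves bijectivity.\<close>
    have "d * F (d * y) = a * d ^ 2 * y - l y" if "y \<in> K" for y
    proof -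
      have inv: "d * inverse (d * y - d * c) = inverse (y - c)" for c
        using d0 by (simp add: right_diff_distrib[symmetric])
      have "d * F (d * y) = a * d ^ 2 * y + d * inverse (d * y - r1) + d * inverse (d * y - r2)
          + d * inverse (d * y - r3)"
        by (simp add: F_def distrib_left power2_eq_square)
      also have "\<dots> = a * d ^ 2 * y + inverse (y - \<rho>) + inverse (y - (\<rho> + 1)) + inverse (y - (\<rho> - 1))"
        unfolding r(1) unfolding r(2,3) inv ..
      also have "\<dots> = a * d ^ 2 * y - l y"
        using pole_power_sums(1)[OF that] by (simp add: algebra_simps)
      finally show ?thesis .
    qed
    then have "bij_betw (\<lambda>y. d * F (d * y)) K K \<longleftrightarrow> bij_betw (\<lambda>y. (a * d ^ 2) * y - l y) K K"
      by (intro bij_betw_cong) simp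
    also have "\<dots> \<longleftrightarrow> a * d ^ 2 = - 1"
      using q dK d0 assms(4,6,7) by (intro bij_betw_iff) auto
    also have "\<dots> \<longleftrightarrow> a = - inverse ((r1 - r2)\<^sup>2)"
      using d0 r12 by (simp add: d_def power2_commute[of r1] field_simps)
    also have "bij_betw (\<lambda>y. d * F (d * y)) K K \<longleftrightarrow> bij_betw F K K"
    proof -
      note bij_d = bij_betw_subfield_mult[OF K dK d0]
      have "bij_betw F K K \<longleftrightarrow> bij_betw ((\<lambda>x. d * x) \<circ> F) K K"
        by (rule bij_betw_comp_iff2[OF bij_d]) (auto simp: F_mem)
      also have "\<dots> \<longleftrightarrow> bij_betw (((\<lambda>x. d * x) \<circ> F) \<circ> (\<lambda>x. d * x)) K K"
        by (rule bij_betw_comp_iff[OF bij_d])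
      finally show ?thesis by (simp add: comp_def)
    qed
    finally show ?thesis .
  qed
  have trace: "r3 - r2 = r2 - r1 \<longleftrightarrow> r1 + r2 + r3 = 0"
  proof -
    have "r3 - r2 - (r2 - r1) = r1 + r2 + r3 - 3 * r2" by (simp add: algebra_simps)
    then have "r3 - r2 - (r2 - r1) = r1 + r2 + r3" unfolding 3 by simp
    then show ?thesis by (metis right_minus_eq)
  qed
  have "r3 - r2 = r2 - r1" if bij: "bij_betw F K K"
  proof -
    have Carlitz: "(\<Sum>x\<in>K. inverse (x - s)) = inverse (s ^ q - s)" if "s \<notin> K" for s
      using sum_inverse_power_subfield[OF K fin _ 3 that, of n 1] q assms(2,4) by simp
    have sum0: "(\<Sum>x\<in>K. x) = 0"
      using sum_power_subfield_eq_0[OF K fin, of 1] q assms(4) by simp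
    \<comment> \<open>The cyclic differences of the poles add up to 0; the first power sum makes
      their inverses do so too, which forces two of them to be equal.\<close>
    have "0 = (\<Sum>x\<in>K. F x)"
      using sum.reindex_bij_betw[OF bij, of "\<lambda>x. x"] sum0 by simp
    also have "\<dots> = inverse (r2 - r1) + inverse (r3 - r2) + inverse (r1 - r3)"
      using sum0 Carlitz notin cyc by (simp add: F_def sum.distrib sum_distrib_left[symmetric])
    finally have "inverse (r3 - r2) + inverse (r2 - r1) + inverse (r1 - r3) = 0"
      by (simp add: add.commute)
    moreover have "r3 - r2 \<noteq> 0" "r2 - r1 \<noteq> 0" "r1 - r3 \<noteq> 0" using r12 r23 r13 by simp_all
    moreover have "(r3 - r2) + (r2 - r1) + (r1 - r3) = 0" by simp
    ultimately show ?thesis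
      using char3_equal_of_sum_inverse[OF 3] by blast
  qed
  then have "bij_betw F K K \<longleftrightarrow> r1 + r2 + r3 = 0 \<and> a = - inverse ((r1 - r2)\<^sup>2)"
    unfolding trace[symmetric] using spaced by meson
  then show ?thesis
    unfolding permutation_ratfun_def bij_iff using ratfun_mem by simp
qed

end
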